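(* If $n \ge 4$ then there are $9n-11 + \lfloor\frac{n-3}{4}\rfloor$ smooth arithmetical structures on the graph $\mathcal{P}_{2,n}$. Moreover, there are $17$ smooth structures on $\mathcal{P}_{2,3}$, eight smooth structures on $\mathcal{P}_{2,2}$ and three smooth structures on $\mathcal{P}_{2,1}$.
   Context: An arithmetical structure on a graph $G$ is an assignment to each vertex of a nonnegative integer label such that the set of all labels has gcd $1$ and the label of each vertex divides the sum of the labels of its neighbors, counted with multiplicity. The graph $\mathcal{P}_{2,n}$ has vertices $a_1,a_2,b_1,\ldots,b_n$, a single edge between $a_1$ and $a_2$, a single edge between $b_i$ and $b_{i+1}$ ($1\le i<n$), and two edges between $a_1$ and $b_1$. A structure is smooth if $a_1>a_2$ and $b_1>b_2>\cdots>b_n$. Structures are counted with the two sides distinguished. *)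

theory Defs
  imports Main "HOL-Library.Multiset" "HOL-Library.FuncSet"
begin

text \<open>
  A loopless multigraph: the multiset of edges contains the two-element set of endpoints of each
  edge, once for every parallel copy.
\<close>

record 'v mgraph =
  mg_verts :: "'v set"
  mg_edges :: "'v set multiset"

definition neighbor_sum :: "'v mgraph \<Rightarrow> ('v \<Rightarrow> nat) \<Rightarrow> 'v \<Rightarrow> nat" where
  "neighbor_sum G r v = (\<Sum>w\<in>mg_verts G. count (mg_edges G) {v, w} * r w)"

text \<open>
  Labelings are required to be \<^const>\<open>undefined\<close> off the vertex set, so that counting functions
  counts labelings of the vertices. A label may be 0, in which case divisibility says that the
  sum over the neighbors is 0.
\<close>

definition arithmetical_structures :: "'v mgraph \<Rightarrow> ('v \<Rightarrow> nat) set" where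
  "arithmetical_structures G =
     {r \<in> mg_verts G \<rightarrow>\<^sub>E UNIV. Gcd (r ` mg_verts G) = 1 \<and>
        (\<forall>v\<in>mg_verts G. r v dvd neighbor_sum G r v)}"

datatype pvert = Av nat | Bv nat

definition P2 :: "nat \<Rightarrow> pvert mgraph" where
  "P2 n = \<lparr> mg_verts = {Av 1, Av 2} \<union> Bv ` {1..n},
            mg_edges = {#{Av 1, Av 2}#}
              + image_mset (\<lambda>i. {Bv i, Bv (i + 1)}) (mset_set {1..<n})
              + replicate_mset 2 {Av 1, Bv 1} \<rparr>"

definition smooth_structures :: "nat \<Rightarrow> (pvert \<Rightarrow> nat) set" where
  "smooth_structures n =
     {r \<in> arithmetical_structures (P2 n).
        r (Av 1) > r (Av 2) \<and> (\<forall>i\<in>{1..<n}. r (Bv i) > r (Bv (i + 1)))}"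

end

theory Submission
  imports Defs
begin

text \<open>
  Divisibility together with \<open>b\<^sub>i\<^sub>+\<^sub>1 < b\<^sub>i\<close> forces each \<open>b\<^sub>i\<^sub>+\<^sub>1\<close> to be the residue of \<open>-b\<^sub>i\<^sub>-\<^sub>1\<close> modulo \<open>b\<^sub>i\<close>,
  where \<open>b\<^sub>0 = 2 a\<^sub>1\<close>; likewise \<open>a\<^sub>2\<close> is the residue of \<open>-2 b\<^sub>1\<close> modulo \<open>a\<^sub>1\<close>. So a smooth structure is
  determined by the coprime pair \<open>(x, y) = (a\<^sub>1, b\<^sub>1)\<close>, and \<open>n\<close> is the length \<open>len (2x) y\<close> of the Euclidean
  algorithm with negative remainders. This length obeys the subtractive rules
  \<open>len (u + v) v = len u v\<close> and \<open>len u (u + v) = len u v + 1\<close>.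

  Since \<open>a\<^sub>2\<close> divides both \<open>x\<close> and \<open>2y\<close>, it is 1 or 2, so \<open>x\<close> is odd and divides \<open>2y + 1\<close>, or \<open>x\<close> is even
  and divides \<open>2y + 2\<close>. The map \<open>(x, y) \<mapsto> (x, y + 2x)\<close> raises \<open>n\<close> by one, and the pairs outside its
  image are those with \<open>y < 2x\<close>. There the quotient \<open>(2y + 1) / x\<close> or \<open>(2y + 2) / x\<close> is at most 4, which
  leaves finitely many linear families whose lengths are computed explicitly. For \<open>n \<ge> 5\<close> each length is
  attained 9 times, and once more, by \<open>y = 2x - 1\<close>, if \<open>n mod 4 = 3\<close>.
\<close>

section \<open>Negative remainders and the chains they generate\<close>

definition co_mod :: "nat \<Rightarrow> nat \<Rightarrow> nat" where
  "co_mod u v = (v - u mod v) mod v"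

lemma co_mod_less: "0 < v \<Longrightarrow> co_mod u v < v"
  by (simp add: co_mod_def)

lemma dvd_add_co_mod:
  assumes "0 < v"
  shows "v dvd u + co_mod u v"
proof -
  have "u mod v \<le> v" using assms by simp
  then have "(u + co_mod u v) mod v = (u mod v + (v - u mod v)) mod v"
    unfolding co_mod_def by (metis mod_add_left_eq mod_add_right_eq)
  then show ?thesis
    using \<open>u mod v \<le> v\<close> by (simp add: dvd_eq_mod_eq_0)
qed

lemma co_mod_unique:
  assumes "w < v" "v dvd u + w"
  shows "w = co_mod u v"
proof -
  let ?c = "co_mod u v"
  have c: "?c < v" "v dvd u + ?c" using assms by (simp_all add: co_mod_less dvd_add_co_mod)
  have "v dvd w - ?c" "v dvd ?c - w"
    using dvd_diff_nat[OF assms(2) c(2)] dvd_diff_nat[OF c(2) assms(2)] by simp_all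
  then show ?thesis using assms c by (auto dest!: dvd_imp_le)
qed

lemma co_mod_add: "co_mod (u + v) v = co_mod u v"
  by (simp add: co_mod_def)

lemma co_mod_eq_diff: "0 < u \<Longrightarrow> u < v \<Longrightarrow> co_mod u v = v - u"
  by (simp add: co_mod_def)

function chain_len :: "nat \<Rightarrow> nat \<Rightarrow> nat" where
  "chain_len u v = (if v = 0 then 0 else Suc (chain_len v (co_mod u v)))"
  by pat_completeness auto
termination by (relation "measure snd") (auto simp: co_mod_less)

declare chain_len.simps [simp del]

text \<open>Indexed so that, for \<open>u = 2 * r (Av 1)\<close> and \<open>v = r (Bv 1)\<close>,
  index \<open>i \<ge> 1\<close> belongs to the vertex \<open>Bv i\<close>. \<open>chain_len\<close>
  counts the terms from index 1 up to, but excluding, the first zero.\<close>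

fun chain :: "nat \<Rightarrow> nat \<Rightarrow> nat \<Rightarrow> nat" where
  "chain u v 0 = u"
| "chain u v (Suc i) = chain v (co_mod u v) i"

lemma chain_len_0 [simp]: "chain_len u 0 = 0"
  by (simp add: chain_len.simps)

lemma chain_len_pos: "0 < v \<Longrightarrow> chain_len u v = Suc (chain_len v (co_mod u v))"
  by (subst chain_len.simps) simp

lemma chain_rec: "chain u v (Suc (Suc i)) = co_mod (chain u v i) (chain u v (Suc i))"
  by (induction i arbitrary: u v) auto

lemma chain_pos: "i < chain_len u v \<Longrightarrow> 0 < chain u v (Suc i)"
proof (induction i arbitrary: u v)
  case 0
  then show ?case by (cases "v = 0") auto
next
  case (Suc i)
  then have "0 < v" by (cases "v = 0") auto
  with Suc show ?case by (auto simp: chain_len_pos)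
qed

lemma chain_end: "chain u v (Suc (chain_len u v)) = 0"
proof (induction u v rule: chain_len.induct)
  case (1 u v)
  then show ?case by (cases "v = 0") (auto simp: chain_len_pos)
qed

text \<open>Makes the passage from local conditions to two initial labels: a sequence that obeys the
  recursion until it reaches 0 is a chain. The induction drops the first term.\<close>

lemma chain_unique:
  assumes "\<And>i. i < n \<Longrightarrow> 0 < b (Suc i) \<and> b (Suc (Suc i)) = co_mod (b i) (b (Suc i))"
    and "b (Suc n) = 0"
  shows "chain_len (b 0) (b 1) = n \<and> (\<forall>i\<le>Suc n. chain (b 0) (b 1) i = b i)"
  using assms
proof (induction n arbitrary: b)
  case 0
  then show ?case by (auto simp: le_Suc_eq)
next
  case (Suc n)
  have *: "chain_len (b 1) (b 2) = n \<and> (\<forall>i\<le>Suc n. chain (b 1) (b 2) i = b (Suc i))"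
    unfolding numeral_2_eq_2 One_nat_def
  proof (rule Suc.IH[of "\<lambda>i. b (Suc i)", unfolded One_nat_def])
    show "0 < b (Suc (Suc i)) \<and> b (Suc (Suc (Suc i))) = co_mod (b (Suc i)) (b (Suc (Suc i)))"
      if "i < n" for i
      using that by (intro Suc.prems(1)) simp
  qed (rule Suc.prems(2))
  have b2: "co_mod (b 0) (b 1) = b 2" "0 < b 1"
    using Suc.prems(1)[of 0] by (auto simp: numeral_2_eq_2)
  show ?case
  proof (intro conjI allI impI)
    show "chain_len (b 0) (b 1) = Suc n" using * b2 by (simp add: chain_len_pos)
    fix i assume "i \<le> Suc (Suc n)"
    then show "chain (b 0) (b 1) i = b i" using * b2 by (cases i) auto
  qed
qed

text \<open>\<open>co_mod u v\<close> sees \<open>u\<close> only modulo \<open>v\<close>.\<close>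

lemma chain_len_add_left: "chain_len (u + v) v = chain_len u v"
  by (cases "v = 0") (simp_all add: chain_len_pos co_mod_add)

text \<open>The residue of \<open>-u\<close> modulo \<open>u + v\<close> is \<open>v\<close>, so one
  step leads to the pair \<open>(u + v, v)\<close>, which \<open>chain_len_add_left\<close> reduces
  to \<open>(u, v)\<close>.\<close>

lemma chain_len_add_right:
  assumes "0 < u" "0 < v"
  shows "chain_len u (u + v) = Suc (chain_len u v)"
  using assms by (simp add: chain_len_pos[of "u + v"] co_mod_eq_diff chain_len_add_left)

lemma chain_len_mult_left: "chain_len (k * v + u) v = chain_len u v"
proof (induction k)
  case (Suc k)
  then show ?case using chain_len_add_left[of "k * v + u" v] by (simp add: ac_simps)
qed simp

lemma chain_len_mult_right:
  assumes "0 < u" "0 < v"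
  shows "chain_len u (k * u + v) = k + chain_len u v"
proof (induction k)
  case (Suc k)
  then show ?case using chain_len_add_right[of u "k * u + v"] assms by (simp add: ac_simps)
qed simp

lemma chain_len_one [simp]: "chain_len u (Suc 0) = Suc 0"
  by (simp add: chain_len_pos co_mod_def)

lemma chain_len_self: "0 < v \<Longrightarrow> chain_len v v = 1"
  by (simp add: chain_len_pos co_mod_def)

section \<open>Neighbor sums in the graph\<close>

lemma count_path_edges:
  "count (image_mset (\<lambda>i. {Bv i, Bv (i + 1)}) (mset_set {1..<n})) {Bv i, Bv j} =
     (if i \<in> {1..<n} \<and> j = i + 1 then 1 else 0) + (if j \<in> {1..<n} \<and> i = j + 1 then 1 else 0)"
proof -
  let ?f = "\<lambda>i. {Bv i, Bv (i + 1)}"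
  have cnt: "count (image_mset ?f (mset_set {1..<n})) (?f k) = (if k \<in> {1..<n} then 1 else 0)" for k
  proof -
    \<comment> \<open>Matching the endpoints crosswise would need both \<open>i = k + 1\<close> and
      \<open>i + 1 = k\<close>.\<close>
    have "{Bv i, Bv (i + 1)} = {Bv k, Bv (k + 1)} \<longleftrightarrow> i = k" for i
      by (simp add: doubleton_eq_iff) linarith
    then have "?f -` {?f k} = {k}" by (simp add: vimage_def)
    then show ?thesis by (simp only: count_image_mset) simp
  qed
  consider "j = i + 1" | "i = j + 1" | "j \<noteq> i + 1" "i \<noteq> j + 1" by blast
  then show ?thesis
  proof cases
    case 1 then show ?thesis using cnt[of i] by simp
  next
    case 2 then show ?thesis using cnt[of j] by (simp add: insert_commute)
  next
    case 3
    then have "{Bv i, Bv j} \<noteq> ?f k" for k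
      by (simp add: doubleton_eq_iff)
    then have "{Bv i, Bv j} \<notin> ?f ` set_mset (mset_set {1..<n})" by blast
    then have "count (image_mset ?f (mset_set {1..<n})) {Bv i, Bv j} = 0"
      by (simp only: count_eq_zero_iff set_image_mset not_False_eq_True)
    with 3 show ?thesis by (simp only:) simp
  qed
qed

lemma count_path_edges_Av:
  "count (image_mset (\<lambda>i. {Bv i, Bv (i + 1)}) (mset_set {1..<n})) {Av i, w} = 0"
  "count (image_mset (\<lambda>i. {Bv i, Bv (i + 1)}) (mset_set {1..<n})) {w, Av i} = 0"
  by (auto simp: count_eq_zero_iff doubleton_eq_iff)

lemma neighbor_sum_P2:
  "neighbor_sum (P2 n) r v =
     count (mg_edges (P2 n)) {v, Av 1} * r (Av 1) + count (mg_edges (P2 n)) {v, Av 2} * r (Av 2)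
     + (\<Sum>j = 1..n. count (mg_edges (P2 n)) {v, Bv j} * r (Bv j))"
proof -
  have "sum f (Bv ` {1..n}) = (\<Sum>j = 1..n. f (Bv j))" for f :: "pvert \<Rightarrow> nat"
    by (subst sum.reindex) (auto simp: inj_on_def)
  moreover have "mg_verts (P2 n) = {Av 1, Av 2} \<union> Bv ` {1..n}" by (simp add: P2_def)
  moreover have "sum f ({Av 1, Av 2} \<union> Bv ` {1..n}) = f (Av 1) + f (Av 2) + sum f (Bv ` {1..n})"
    for f :: "pvert \<Rightarrow> nat"
    by (subst sum.union_disjoint) auto
  ultimately show ?thesis
    unfolding neighbor_sum_def by (simp only:)
qed

lemma sum_mult_if_eq:
  "finite A \<Longrightarrow> (\<Sum>j\<in>A. (if j = i then c else 0) * f j) = (if i \<in> A then c * f i else (0::nat))"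
  by (simp add: if_distrib[of "\<lambda>x. x * _"] sum.delta cong: if_cong)

lemma neighbor_sum_Av:
  assumes "1 \<le> n"
  shows "neighbor_sum (P2 n) r (Av 1) = r (Av 2) + 2 * r (Bv 1)"
    and "neighbor_sum (P2 n) r (Av 2) = r (Av 1)"
proof -
  have "count (mg_edges (P2 n)) {Av 1, Av 1} = 0" "count (mg_edges (P2 n)) {Av 1, Av 2} = 1"
    "count (mg_edges (P2 n)) {Av 2, Av 1} = 1" "count (mg_edges (P2 n)) {Av 2, Av 2} = 0"
    "count (mg_edges (P2 n)) {Av 1, Bv j} = (if j = 1 then 2 else 0)"
    "count (mg_edges (P2 n)) {Av 2, Bv j} = 0" for j
    by (simp_all only: P2_def mgraph.simps count_union count_path_edges_Av)
      (auto simp: doubleton_eq_iff)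
  then show "neighbor_sum (P2 n) r (Av 1) = r (Av 2) + 2 * r (Bv 1)"
    and "neighbor_sum (P2 n) r (Av 2) = r (Av 1)"
    using assms by (simp_all only: neighbor_sum_P2 sum_mult_if_eq finite_atLeastAtMost) auto
qed

text \<open>
  The \<open>b\<close>-side extended by \<open>b\<^sub>0 = 2 a\<^sub>1\<close> (the double edge) and \<open>b\<^sub>n\<^sub>+\<^sub>1 = 0\<close>, so that the condition at
  \<open>b\<^sub>i\<close> has the same form for all \<open>1 \<le> i \<le> n\<close>.
\<close>

definition blabel :: "nat \<Rightarrow> (pvert \<Rightarrow> nat) \<Rightarrow> nat \<Rightarrow> nat" where
  "blabel n r i = (if i = 0 then 2 * r (Av 1) else if i \<le> n then r (Bv i) else 0)"

lemma neighbor_sum_Bv: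
  assumes "i < n"
  shows "neighbor_sum (P2 n) r (Bv (Suc i)) = blabel n r i + blabel n r (Suc (Suc i))"
proof -
  let ?c = "\<lambda>w. count (mg_edges (P2 n)) {Bv (Suc i), w}"
  have A: "?c (Av 1) = (if i = 0 then 2 else 0)" "?c (Av 2) = 0"
    using count_path_edges_Av[of n] by (auto simp: P2_def doubleton_eq_iff)
  \<comment> \<open>For \<open>i = 0\<close> the second indicator never fires, since
    \<open>j \<ge> 1\<close>; the term of index 0 then comes from the double edge to
    \<open>Av 1\<close>, counted in \<open>A\<close>.\<close>
  have B: "?c (Bv j) * r (Bv j) = (if j = Suc (Suc i) then 1 else 0) * r (Bv j) + (if j = i then 1 else 0) * r (Bv j)"
    if "j \<in> {1..n}" for j
    using that assms by (simp only: P2_def mgraph.simps count_union count_path_edges) (auto simp: doubleton_eq_iff)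
  have "(\<Sum>j = 1..n. ?c (Bv j) * r (Bv j)) =
      (if Suc (Suc i) \<le> n then r (Bv (Suc (Suc i))) else 0) + (if 1 \<le> i then r (Bv i) else 0)"
    using assms by (simp only: B sum.distrib sum_mult_if_eq finite_atLeastAtMost cong: sum.cong) auto
  then show ?thesis using A assms by (auto simp: neighbor_sum_P2 blabel_def)
qed

section \<open>Smooth structures as coprime pairs of labels\<close>

lemma dvd_co_mod:
  assumes "d dvd u" "d dvd v"
  shows "d dvd co_mod u v"
proof (cases "v = 0")
  case False
  then have "d dvd u + co_mod u v" using dvd_add_co_mod assms dvd_trans by blast
  then show ?thesis using assms by (simp add: dvd_add_right_iff)
qed (simp add: co_mod_def)

lemma dvd_chain: "d dvd u \<Longrightarrow> d dvd v \<Longrightarrow> d dvd chain u v i"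
  by (induction i arbitrary: u v) (auto simp: dvd_co_mod)

lemma verts_P2: "mg_verts (P2 n) = {Av 1, Av 2} \<union> Bv ` {1..n}"
  by (simp add: P2_def)

lemma smooth_structures_iff:
  assumes "1 \<le> n"
  shows "r \<in> smooth_structures n \<longleftrightarrow>
    r \<in> mg_verts (P2 n) \<rightarrow>\<^sub>E UNIV \<and> Gcd (r ` mg_verts (P2 n)) = 1 \<and>
    r (Av 2) < r (Av 1) \<and> r (Av 1) dvd 2 * r (Bv 1) + r (Av 2) \<and> r (Av 2) dvd r (Av 1) \<and>
    (\<forall>i<n. blabel n r (Suc i) dvd blabel n r i + blabel n r (Suc (Suc i))) \<and>
    (\<forall>i\<in>{1..<n}. r (Bv (Suc i)) < r (Bv i))"
proof -
  have "(\<forall>v\<in>Bv ` {1..n}. r v dvd neighbor_sum (P2 n) r v) \<longleftrightarrow>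
      (\<forall>i<n. r (Bv (Suc i)) dvd neighbor_sum (P2 n) r (Bv (Suc i)))"
    by (auto simp: Ball_def) (metis Suc_le_D Suc_le_lessD)
  also have "\<dots> \<longleftrightarrow> (\<forall>i<n. blabel n r (Suc i) dvd blabel n r i + blabel n r (Suc (Suc i)))"
    by (auto simp: neighbor_sum_Bv) (simp_all add: blabel_def)
  finally show ?thesis
    unfolding smooth_structures_def arithmetical_structures_def
    using neighbor_sum_Av[OF assms, of r]
    by (simp add: verts_P2 ball_Un add.commute conj_ac del: One_nat_def) simp
qed

text \<open>Zero labels are excluded: \<open>blabel n r i\<close> is positive because it is twice
  \<open>r (Av 1) > r (Av 2)\<close> or exceeds the next label, so the sum at
  \<open>Bv (Suc i)\<close> is positive and its divisor is not 0.\<close>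

lemma smooth_blabel:
  assumes "1 \<le> n" "r \<in> smooth_structures n" "i < n"
  shows "0 < blabel n r (Suc i)"
    and "blabel n r (Suc (Suc i)) = co_mod (blabel n r i) (blabel n r (Suc i))"
proof -
  have r: "r (Av 2) < r (Av 1)"
    "blabel n r (Suc i) dvd blabel n r i + blabel n r (Suc (Suc i))"
    "\<And>i. i \<in> {1..<n} \<Longrightarrow> r (Bv (Suc i)) < r (Bv i)"
    using assms by (auto simp: smooth_structures_iff)
  have "0 < blabel n r i"
    using r(1) r(3)[of i] assms(3) by (cases "i = 0") (auto simp: blabel_def)
  then show pos: "0 < blabel n r (Suc i)"
    using r(2) by (auto intro!: Nat.gr0I)
  \<comment> \<open>At \<open>Suc i = n\<close> the bound comes from the value 0 beyond the end of
    the path.\<close>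
  then have "blabel n r (Suc (Suc i)) < blabel n r (Suc i)"
    using r(3)[of "Suc i"] assms(3) by (auto simp: blabel_def)
  then show "blabel n r (Suc (Suc i)) = co_mod (blabel n r i) (blabel n r (Suc i))"
    using r(2) by (rule co_mod_unique)
qed

lemma smooth_determined:
  assumes "1 \<le> n" "r \<in> smooth_structures n"
  shows "chain_len (2 * r (Av 1)) (r (Bv 1)) = n"
    and "\<And>i. i \<in> {1..n} \<Longrightarrow> r (Bv i) = chain (2 * r (Av 1)) (r (Bv 1)) i"
    and "r (Av 2) = co_mod (2 * r (Bv 1)) (r (Av 1))"
proof -
  have b: "blabel n r 0 = 2 * r (Av 1)" "blabel n r 1 = r (Bv 1)" "blabel n r (Suc n) = 0"
    "\<And>i. i \<in> {1..n} \<Longrightarrow> blabel n r i = r (Bv i)"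
    using assms(1) by (auto simp: blabel_def)
  have *: "chain_len (2 * r (Av 1)) (r (Bv 1)) = n \<and>
      (\<forall>i\<le>Suc n. chain (2 * r (Av 1)) (r (Bv 1)) i = blabel n r i)"
    using chain_unique[of n "blabel n r", unfolded b(1,2)] smooth_blabel[OF assms] b(3) by blast
  then show "chain_len (2 * r (Av 1)) (r (Bv 1)) = n" by blast
  show "r (Bv i) = chain (2 * r (Av 1)) (r (Bv 1)) i" if "i \<in> {1..n}" for i
    using * that b(4)[OF that] by simp
  show "r (Av 2) = co_mod (2 * r (Bv 1)) (r (Av 1))"
    using assms by (intro co_mod_unique) (auto simp: smooth_structures_iff)
qed

text \<open>Labels built as residues meet the divisibility conditions at \<open>Av 1\<close> and
  along the path by construction; what remains is the gcd, the condition at \<open>Av 2\<close> and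
  the number of vertices.\<close>

definition smooth_pairs :: "nat \<Rightarrow> (nat \<times> nat) set" where
  "smooth_pairs n =
     {(x, y). 0 < x \<and> coprime x y \<and> co_mod (2 * y) x dvd x \<and> chain_len (2 * x) y = n}"

definition labels_of_pair :: "nat \<Rightarrow> nat \<times> nat \<Rightarrow> pvert \<Rightarrow> nat" where
  "labels_of_pair n = (\<lambda>(x, y). restrict
     (\<lambda>v. case v of Av i \<Rightarrow> if i = 1 then x else co_mod (2 * y) x | Bv i \<Rightarrow> chain (2 * x) y i)
     (mg_verts (P2 n)))"

text \<open>All labels arise from \<open>r (Av 1)\<close> and \<open>r (Bv 1)\<close> by
  \<open>co_mod\<close> steps, which preserve common divisors.\<close>

lemma Gcd_labels_eq_1_iff:
  assumes n: "1 \<le> n" and r: "r (Av 2) = co_mod (2 * r (Bv 1)) (r (Av 1))"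
    "\<And>i. i \<in> {1..n} \<Longrightarrow> r (Bv i) = chain (2 * r (Av 1)) (r (Bv 1)) i"
  shows "Gcd (r ` mg_verts (P2 n)) = 1 \<longleftrightarrow> coprime (r (Av 1)) (r (Bv 1))"
proof -
  have "Gcd (r ` mg_verts (P2 n)) = gcd (r (Av 1)) (r (Bv 1))"
  proof (rule dvd_antisym)
    show "Gcd (r ` mg_verts (P2 n)) dvd gcd (r (Av 1)) (r (Bv 1))"
      using n by (intro gcd_greatest Gcd_dvd) (auto simp: verts_P2)
    have "gcd (r (Av 1)) (r (Bv 1)) dvd r v" if v: "v \<in> mg_verts (P2 n)" for v
    proof -
      have "gcd (r (Av 1)) (r (Bv 1)) dvd r (Av 2)"
        unfolding r(1) by (intro dvd_co_mod dvd_mult) auto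
      moreover have "gcd (r (Av 1)) (r (Bv 1)) dvd r (Bv i)" if "i \<in> {1..n}" for i
        unfolding r(2)[OF that] by (intro dvd_chain dvd_mult) auto
      ultimately show ?thesis using v by (auto simp: verts_P2)
    qed
    then show "gcd (r (Av 1)) (r (Bv 1)) dvd Gcd (r ` mg_verts (P2 n))"
      by (intro Gcd_greatest) auto
  qed
  then show ?thesis by (simp add: coprime_iff_gcd_eq_1)
qed

lemma labels_of_pair_smooth:
  assumes n: "1 \<le> n" and p: "(x, y) \<in> smooth_pairs n"
  shows "labels_of_pair n (x, y) \<in> smooth_structures n"
proof -
  let ?r = "labels_of_pair n (x, y)"
  have xy: "0 < x" "coprime x y" "co_mod (2 * y) x dvd x" "chain_len (2 * x) y = n"
    using p by (auto simp: smooth_pairs_def)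
  have A: "?r (Av 1) = x" "?r (Av 2) = co_mod (2 * y) x"
    and B: "\<And>i. i \<in> {1..n} \<Longrightarrow> ?r (Bv i) = chain (2 * x) y i"
    by (auto simp: labels_of_pair_def verts_P2)
  have B1: "?r (Bv 1) = y" using B[of 1] n by simp
  have bl: "blabel n ?r i = chain (2 * x) y i" if "i \<le> Suc n" for i
    using that A(1) B[of i] chain_end[of "2 * x" y] xy(4)
    by (cases "i = 0"; cases "i = Suc n") (auto simp: blabel_def)
  have pos: "0 < chain (2 * x) y (Suc i)" if "i < n" for i
    using chain_pos[of i "2 * x" y] xy(4) that by simp
  have dv: "blabel n ?r (Suc i) dvd blabel n ?r i + blabel n ?r (Suc (Suc i))" if "i < n" for i
    using that pos[OF that] by (simp only: bl chain_rec dvd_add_co_mod less_imp_le Suc_leI Suc_le_mono)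
  have dec: "?r (Bv (Suc i)) < ?r (Bv i)" if i: "i \<in> {1..<n}" for i
  proof -
    obtain j where j: "i = Suc j" using i by (cases i) auto
    have "chain (2 * x) y (Suc (Suc j)) < chain (2 * x) y (Suc j)"
      unfolding chain_rec using i pos[of j] j by (intro co_mod_less) simp
    then show ?thesis using i j by (simp only: B[of i] B[of "Suc i"] atLeastAtMost_iff) (simp add: B)
  qed
  have "Gcd (?r ` mg_verts (P2 n)) = 1"
    using Gcd_labels_eq_1_iff[of n ?r] n A B B1 xy(2) by simp
  moreover have "?r \<in> mg_verts (P2 n) \<rightarrow>\<^sub>E UNIV" by (simp add: labels_of_pair_def)
  moreover have "x dvd 2 * y + co_mod (2 * y) x" "co_mod (2 * y) x < x"
    using xy(1) by (simp_all add: dvd_add_co_mod co_mod_less)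
  ultimately show ?thesis
    unfolding smooth_structures_iff[OF n] A B1 using dv dec xy(3) by blast
qed

lemma card_smooth_structures:
  assumes n: "1 \<le> n"
  shows "card (smooth_structures n) = card (smooth_pairs n)"
proof (rule bij_betw_same_card)
  show "bij_betw (\<lambda>r. (r (Av 1), r (Bv 1))) (smooth_structures n) (smooth_pairs n)"
  proof (rule bij_betwI[where g = "labels_of_pair n"])
    show "(\<lambda>r. (r (Av 1), r (Bv 1))) \<in> smooth_structures n \<rightarrow> smooth_pairs n"
    proof
      fix r assume r: "r \<in> smooth_structures n"
      have "coprime (r (Av 1)) (r (Bv 1))"
        using Gcd_labels_eq_1_iff[OF n smooth_determined(3,2)[OF n r]] r
        by (simp only: smooth_structures_iff[OF n])
      then show "(r (Av 1), r (Bv 1)) \<in> smooth_pairs n"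
        using smooth_determined(1,3)[OF n r] r n by (auto simp: smooth_pairs_def smooth_structures_iff)
    qed
    show "labels_of_pair n \<in> smooth_pairs n \<rightarrow> smooth_structures n"
      using labels_of_pair_smooth[OF n] by auto
    show "labels_of_pair n (r (Av 1), r (Bv 1)) = r" if r: "r \<in> smooth_structures n" for r
    proof
      fix v
      show "labels_of_pair n (r (Av 1), r (Bv 1)) v = r v"
      proof (cases "v \<in> mg_verts (P2 n)")
        case True
        then show ?thesis
          by (auto simp: labels_of_pair_def verts_P2 smooth_determined(3)[OF n r, symmetric]
              smooth_determined(2)[OF n r, symmetric] simp del: One_nat_def)
      next
        case False
        \<comment> \<open>Off the vertex set both functions are \<open>undefined\<close>.\<close>
        moreover have "r \<in> extensional (mg_verts (P2 n))"
          using r n by (auto simp: smooth_structures_iff PiE_def)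
        ultimately show ?thesis by (simp add: labels_of_pair_def extensional_def)
      qed
    qed
    show "(labels_of_pair n p (Av 1), labels_of_pair n p (Bv 1)) = p" for p
      using n by (cases p) (simp add: labels_of_pair_def verts_P2 image_iff)
  qed
qed

section \<open>Divisibility form of the pairs, and the shift of \<open>y\<close> by
  \<open>2 * x\<close>\<close>

lemma co_mod_dvd_iff:
  fixes x y :: nat
  shows "0 < x \<and> coprime x y \<and> co_mod (2 * y) x dvd x \<longleftrightarrow>
    odd x \<and> 1 < x \<and> x dvd 2 * y + 1 \<or> even x \<and> 2 < x \<and> odd y \<and> x dvd 2 * y + 2"
    (is "?L \<longleftrightarrow> ?R")
proof
  let ?a = "co_mod (2 * y) x"
  assume ?L
  then have x: "0 < x" "coprime x y" "?a dvd x" by auto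
  have a: "?a < x" "x dvd 2 * y + ?a" using x(1) by (simp_all add: co_mod_less dvd_add_co_mod)
  \<comment> \<open>\<open>?a\<close> divides \<open>x\<close>, hence \<open>2 * y + ?a\<close>,
    hence \<open>2 * y\<close>; being coprime to \<open>y\<close>, it divides 2.\<close>
  have "?a dvd 2 * y" using dvd_trans[OF x(3) a(2)] by (simp add: dvd_add_left_iff)
  moreover have "coprime ?a y" using x(2,3) by (rule coprime_divisors[OF _ dvd_refl, rotated])
  ultimately have "?a dvd 2" by (simp add: coprime_dvd_mult_left_iff)
  moreover have "d = 1 \<or> d = 2" if "d dvd 2" for d :: nat
    using that dvd_imp_le[OF that] by (cases "d = 0") auto
  ultimately have "?a = 1 \<or> ?a = 2" by blast
  then show ?R
  proof
    assume "?a = 1"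
    with a have "1 < x" "x dvd 2 * y + 1" by auto
    moreover have "odd x"
      using \<open>x dvd 2 * y + 1\<close> dvd_trans[of 2 x "2 * y + 1"] by auto
    ultimately show ?R by blast
  next
    assume "?a = 2"
    with a x have "2 < x" "x dvd 2 * y + 2" "even x" by auto
    moreover have "odd y" using \<open>even x\<close> x(2) by (auto dest: coprime_common_divisor)
    ultimately show ?R by blast
  qed
next
  assume ?R
  then show ?L
  proof
    assume x: "odd x \<and> 1 < x \<and> x dvd 2 * y + 1"
    then have "co_mod (2 * y) x = 1" using co_mod_unique[of 1 x "2 * y"] by simp
    moreover have "coprime x y"
    proof (rule coprimeI)
      fix d assume "d dvd x" "d dvd y"
      then have "d dvd 2 * y + 1" "d dvd 2 * y" using x dvd_trans by auto
      then show "is_unit d" using dvd_diff_nat[of d "2 * y + 1" "2 * y"] by simp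
    qed
    ultimately show ?L using x by simp
  next
    assume x: "even x \<and> 2 < x \<and> odd y \<and> x dvd 2 * y + 2"
    then have "co_mod (2 * y) x = 2" using co_mod_unique[of 2 x "2 * y"] by simp
    moreover have "coprime x y"
    proof (rule coprimeI)
      fix d assume d: "d dvd x" "d dvd y"
      then have "d dvd 2 * y + 2" "d dvd 2 * y" using x dvd_trans by auto
      then have "d dvd 2" using dvd_diff_nat[of d "2 * y + 2" "2 * y"] by simp
      moreover have "coprime 2 y" using x by simp
      ultimately show "is_unit d" using d(2) coprime_common_divisor by blast
    qed
    ultimately show ?L using x by simp
  qed
qed

definition reduced_pairs :: "nat \<Rightarrow> (nat \<times> nat) set" where
  "reduced_pairs n = {(x, y) \<in> smooth_pairs n. y < 2 * x}"

lemma smooth_pairs_pos: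
  assumes "(x, y) \<in> smooth_pairs n"
  shows "1 < x" "0 < y"
proof -
  have "0 < x \<and> coprime x y \<and> co_mod (2 * y) x dvd x" using assms by (auto simp: smooth_pairs_def)
  then show "1 < x" "0 < y" using co_mod_dvd_iff[of x y] by (auto intro!: Nat.gr0I)
qed

text \<open>Coprimality and the residue depend on \<open>y\<close> only modulo \<open>x\<close>,
  while adding the chain's start \<open>2 * x\<close> to \<open>y\<close> lengthens the chain by
  one.\<close>

lemma smooth_pairs_shift:
  assumes "0 < y"
  shows "(x, y + 2 * x) \<in> smooth_pairs (Suc n) \<longleftrightarrow> (x, y) \<in> smooth_pairs n"
proof -
  have "co_mod (2 * (y + 2 * x)) x = co_mod (2 * y) x"
    by (simp add: co_mod_def algebra_simps)
  moreover have "coprime x (y + 2 * x) \<longleftrightarrow> coprime x y"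
    using gcd_add_mult[of x 2 y] by (simp add: coprime_iff_gcd_eq_1 add.commute)
  moreover have "chain_len (2 * x) (y + 2 * x) = Suc (chain_len (2 * x) y)" if "0 < x"
    using chain_len_add_right[of "2 * x" y] that assms by (simp add: add.commute)
  ultimately show ?thesis by (auto simp: smooth_pairs_def)
qed

lemma smooth_pairs_Suc:
  "smooth_pairs (Suc n) = (\<lambda>(x, y). (x, y + 2 * x)) ` smooth_pairs n \<union> reduced_pairs (Suc n)"
    (is "_ = ?f ` _ \<union> _")
proof (intro subset_antisym subsetI)
  fix p assume p: "p \<in> smooth_pairs (Suc n)"
  obtain x y where xy: "p = (x, y)" by (cases p)
  show "p \<in> ?f ` smooth_pairs n \<union> reduced_pairs (Suc n)"
  proof (cases "y < 2 * x")
    case True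
    then show ?thesis using p xy by (simp add: reduced_pairs_def)
  next
    case False
    define z where "z = y - 2 * x"
    have y: "y = z + 2 * x" using False by (simp add: z_def)
    \<comment> \<open>The shift needs a positive \<open>z\<close>; otherwise
      \<open>y = 2 * x\<close> shares the factor \<open>x > 1\<close> with \<open>x\<close>.\<close>
    have "0 < z"
    proof (rule Nat.gr0I)
      assume "z = 0"
      then have "coprime x (2 * x)" using p xy y by (simp add: smooth_pairs_def)
      then show False using smooth_pairs_pos(1)[of x y] p xy by simp
    qed
    then have "(x, z) \<in> smooth_pairs n" using p xy y smooth_pairs_shift by simp
    then show ?thesis using xy y by force
  qed
next
  fix p assume "p \<in> ?f ` smooth_pairs n \<union> reduced_pairs (Suc n)"
  then show "p \<in> smooth_pairs (Suc n)"
    using smooth_pairs_shift smooth_pairs_pos(2) by (auto simp: reduced_pairs_def)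
qed

lemma smooth_pairs_0: "smooth_pairs 0 = {}"
proof -
  have "chain_len (2 * x) y \<noteq> 0" if "0 < y" for x y using that by (simp add: chain_len_pos)
  moreover have "0 < y \<and> chain_len (2 * x) y = 0" if "(x, y) \<in> smooth_pairs 0" for x y
    using smooth_pairs_pos(2)[OF that] that by (simp add: smooth_pairs_def)
  ultimately show ?thesis by (metis ex_in_conv surj_pair)
qed

section \<open>Chain lengths in the linear families\<close>

lemma chain_len_2: "0 < t \<Longrightarrow> chain_len 2 t = (t + 1) div 2"
proof -
  assume "0 < t"
  then consider p where "t = p * 2 + 1" | p where "t = p * 2 + 2" by atomize_elim presburger
  then show ?thesis
  proof cases
    case 1 then show ?thesis using chain_len_mult_right[of 2 1 p] by simp
  next
    case 2 then show ?thesis using chain_len_mult_right[of 2 2 p] by (simp add: chain_len_self)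
  qed
qed

lemma chain_len_4: "chain_len 4 (4 * p + 1) = p + 1" "chain_len 4 (4 * p + 3) = p + 3"
proof -
  have "chain_len 4 3 = 3"
    using chain_len_add_left[of 1 3] chain_len_mult_right[of 1 1 2] by simp
  then show "chain_len 4 (4 * p + 1) = p + 1" "chain_len 4 (4 * p + 3) = p + 3"
    using chain_len_mult_right[of 4 1 p] chain_len_mult_right[of 4 3 p] by (simp_all add: mult.commute)
qed

text \<open>Here \<open>x = 2 * t + 1\<close>, and \<open>2 * y + 1\<close> is \<open>x\<close> in
  the first case and \<open>3 * x\<close> in the second.\<close>

lemma chain_len_odd:
  "1 \<le> t \<Longrightarrow> chain_len (4 * t + 2) t = (t + 1) div 2"
  "2 \<le> t \<Longrightarrow> chain_len (4 * t + 2) (3 * t + 1) = t div 2 + 2"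
proof -
  show "chain_len (4 * t + 2) t = (t + 1) div 2" if "1 \<le> t"
    using chain_len_mult_left[of 4 t 2] chain_len_2[of t] that by simp
  assume t: "2 \<le> t"
  then obtain s where s: "t = s + 2" by (metis le_Suc_ex add.commute)
  \<comment> \<open>Modulo \<open>3 * t + 1\<close> the first argument becomes
    \<open>t + 1 = s + 3\<close>; two copies of it are then split off the second argument, each
    adding one to the length.\<close>
  have "chain_len (4 * t + 2) (3 * t + 1) = chain_len (s + 3) (2 * (s + 3) + (s + 1))"
    using chain_len_add_left[of "s + 3" "3 * t + 1"] s by (simp add: algebra_simps)
  also have "\<dots> = 2 + chain_len 2 (s + 1)"
    using chain_len_mult_right[of "s + 3" "s + 1" 2] chain_len_add_left[of 2 "s + 1"]
    by (simp add: eval_nat_numeral)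
  finally show "chain_len (4 * t + 2) (3 * t + 1) = t div 2 + 2" using s by (simp add: chain_len_2)
qed

text \<open>The lemmas \<open>chain_len_even_1\<close> to \<open>chain_len_even_4\<close> treat
  \<open>2 * y + 2 = k * x\<close> for \<open>k = 1, 2, 3, 4\<close>. Here
  \<open>2 * x = 4 * y + 4\<close> leaves a chain starting from 4, whose length depends on
  \<open>y mod 4\<close>.\<close>

lemma chain_len_even_1:
  "chain_len (2 * (8 * p + 4)) (4 * p + 1) = p + 1"
  "chain_len (2 * (8 * p + 8)) (4 * p + 3) = p + 3"
  using chain_len_mult_left[of 4 "4 * p + 1" 4] chain_len_mult_left[of 4 "4 * p + 3" 4] chain_len_4[of p]
  by (simp_all add: algebra_simps)

lemma chain_len_even_2: "chain_len (2 * (2 * q + 4)) (2 * q + 3) = q + 2"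
proof -
  have "2 * (2 * q + 4) = 2 * (2 * q + 3) + 2" by simp
  then have "chain_len (2 * (2 * q + 4)) (2 * q + 3) = chain_len 2 (2 * q + 3)"
    by (simp only: chain_len_mult_left)
  then show ?thesis by (simp add: chain_len_2)
qed

lemma chain_len_even_3:
  "chain_len (2 * (8 * p + 8)) (12 * p + 11) = p + 3"
  "chain_len (2 * (8 * p + 12)) (12 * p + 17) = p + 5"
proof -
  \<comment> \<open>\<open>x = 2 * k + 6\<close> and \<open>y = 3 * k + 8\<close> solve
    \<open>2 * y + 2 = 3 * x\<close>; the two claims are \<open>k = 4 * p + 1\<close> and
    \<open>k = 4 * p + 3\<close>.\<close>
  have *: "chain_len (4 * k + 12) (3 * k + 8) = 2 + chain_len 4 k" if "0 < k" for k
  proof -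
    have "chain_len (4 * k + 12) (3 * k + 8) = chain_len (k + 4) (2 * (k + 4) + k)"
      using chain_len_add_left[of "k + 4" "3 * k + 8"] by (simp add: algebra_simps)
    also have "\<dots> = 2 + chain_len 4 k"
      using chain_len_mult_right[of "k + 4" k 2] chain_len_add_left[of 4 k] that
      by (simp add: algebra_simps)
    finally show ?thesis .
  qed
  show "chain_len (2 * (8 * p + 8)) (12 * p + 11) = p + 3"
    "chain_len (2 * (8 * p + 12)) (12 * p + 17) = p + 5"
    using *[of "4 * p + 1"] *[of "4 * p + 3"] chain_len_4[of p] by (simp_all add: algebra_simps)
qed

text \<open>Since \<open>2 * x = y + 1\<close>, the chain descends from \<open>y\<close> in steps of
  1. These lengths, all 3 modulo 4, produce the floor term of the count.\<close>

lemma chain_len_even_4: "chain_len (2 * (2 * q + 4)) (4 * q + 7) = 4 * q + 7"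
  using chain_len_add_left[of 1 "4 * q + 7"] chain_len_mult_right[of 1 1 "4 * q + 6"]
  by (simp add: algebra_simps)

text \<open>The pairs \<open>(3, 4)\<close> and \<open>(4, 5)\<close> have quotient 3, but the
  general reductions would reach a second argument that is not positive.\<close>

lemma chain_len_small: "chain_len 6 4 = 2" "chain_len 8 5 = 3"
proof -
  show "chain_len 6 4 = 2"
    using chain_len_add_left[of 2 4] chain_len_2[of 4] by simp
  have "chain_len 3 2 = 2"
    using chain_len_add_left[of 1 2] chain_len_mult_right[of 1 1 1] by (simp add: eval_nat_numeral)
  then show "chain_len 8 5 = 3"
    using chain_len_add_left[of 3 5] chain_len_add_right[of 3 2] by simp
qed

section \<open>Classification of the reduced pairs\<close>

lemma reduced_cases:
  fixes x y :: nat
  shows "(odd x \<and> 1 < x \<and> x dvd 2 * y + 1 \<or> even x \<and> 2 < x \<and> odd y \<and> x dvd 2 * y + 2) \<and> y < 2 * x \<longleftrightarrow>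
    1 \<le> y \<and> x = 2 * y + 1 \<or> x = 3 \<and> y = 4 \<or> (\<exists>t\<ge>2. x = 2 * t + 1 \<and> y = 3 * t + 1) \<or>
    (\<exists>p. x = 8 * p + 4 \<and> y = 4 * p + 1) \<or> (\<exists>p. x = 8 * p + 8 \<and> y = 4 * p + 3) \<or>
    (\<exists>q. x = 2 * q + 4 \<and> y = 2 * q + 3) \<or>
    x = 4 \<and> y = 5 \<or> (\<exists>p. x = 8 * p + 8 \<and> y = 12 * p + 11) \<or> (\<exists>p. x = 8 * p + 12 \<and> y = 12 * p + 17) \<or>
    (\<exists>q. x = 2 * q + 4 \<and> y = 4 * q + 7)"
    (is "?L \<longleftrightarrow> ?R")
proof
  assume L: ?L
  then have y: "y < 2 * x" by blast
  from L consider "odd x" "1 < x" "x dvd 2 * y + 1" | "even x" "2 < x" "odd y" "x dvd 2 * y + 2"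
    by blast
  then show ?R
  proof cases
    case 1
    obtain k where k: "2 * y + 1 = x * k" using 1(3) by (rule dvdE)
    \<comment> \<open>\<open>y < 2 * x\<close> gives \<open>2 * y + 1 < 4 * x\<close>; as a factor
      of an odd number, \<open>k\<close> can then only be 1 or 3.\<close>
    have "x * k < x * 4" using y k by linarith
    then have "k < 4" by simp
    have "odd k" using k by (metis even_mult_iff even_plus_one_iff dvd_triv_left)
    then consider "k = 1" | "k = 3" using \<open>k < 4\<close> by atomize_elim presburger
    then show ?R
    proof cases
      case b: 1
      have "1 \<le> y \<and> x = 2 * y + 1" using k 1(2) b by simp
      then show ?R by blast
    next
      case 2
      obtain t where t: "x = 2 * t + 1" using 1(1) by (rule oddE)
      then have "y = 3 * t + 1" "1 \<le> t" using k 2 1(2) by simp_all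
      then have "x = 3 \<and> y = 4 \<or> (\<exists>t\<ge>2. x = 2 * t + 1 \<and> y = 3 * t + 1)"
        using t by (cases "t = 1") auto
      then show ?R by blast
    qed
  next
    case 2
    obtain m where m: "x = 2 * m" using 2(1) by (rule evenE)
    obtain w where w: "y = 2 * w + 1" using 2(3) by (rule oddE)
    have parity: "\<exists>p. r = 2 * p \<or> r = 2 * p + 1" for r :: nat by presburger
    obtain k where k: "2 * y + 2 = x * k" using 2(4) by (rule dvdE)
    \<comment> \<open>Now only \<open>2 * y + 2 \<le> 4 * x\<close>, so the quotient 4 survives,
      with \<open>y = 2 * x - 1\<close>.\<close>
    have "x * k < x * 5" using y k 2(2) by linarith
    then have "k < 5" by simp
    moreover have "k \<noteq> 0" using k by (intro notI) simp
    ultimately have "k = 1 \<or> k = 2 \<or> k = 3 \<or> k = 4" by linarith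
    then consider "2 * y + 2 = x" | "2 * y + 2 = 2 * x" | "2 * y + 2 = 3 * x" | "2 * y + 2 = 4 * x"
      using k by (metis mult.commute mult_1)
    then show ?R
    proof cases
      case 1
      obtain p where "w = 2 * p \<or> w = 2 * p + 1" using parity by blast
      then have "x = 8 * p + 4 \<and> y = 4 * p + 1 \<or> x = 8 * p + 8 \<and> y = 4 * p + 3"
        using 1 w by auto
      then show ?R by blast
    next
      case b: 2
      then have "x = 2 * (w - 1) + 4 \<and> y = 2 * (w - 1) + 3" using 2(2) w by auto
      then show ?R by blast
    next
      case 3
      then have *: "2 * (w + 1) = 3 * m" using m w by simp
      then have "even (3 * m)" by (metis dvd_triv_left)
      then obtain s where s: "m = 2 * s" by (auto elim: evenE)
      then have ws: "w + 1 = 3 * s" using * by simp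
      \<comment> \<open>\<open>x = 4 * s\<close>: the value \<open>s = 1\<close> is the exceptional
        pair \<open>(4, 5)\<close>, and for \<open>s \<ge> 2\<close> the parity of \<open>s\<close>
        separates the two families.\<close>
      obtain p where p: "s - 2 = 2 * p \<or> s - 2 = 2 * p + 1" using parity by blast
      have "x = 4 \<and> y = 5 \<or> x = 8 * p + 8 \<and> y = 12 * p + 11 \<or> x = 8 * p + 12 \<and> y = 12 * p + 17"
      proof (cases "s = 1")
        case True
        then show ?thesis using m w s ws by simp
      next
        case False
        then have "s = 2 * p + 2 \<or> s = 2 * p + 3" using p ws by linarith
        then show ?thesis using m w s ws by auto
      qed
      then show ?R by blast
    next
      case 4
      then have "x = 2 * (m - 2) + 4 \<and> y = 4 * (m - 2) + 7" using m 2(2) by (intro conjI; linarith)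
      then show ?R by blast
    qed
  qed
next
  assume ?R
  \<comment> \<open>Each family has an explicit quotient, which witnesses the divisibility.\<close>
  then have "(odd x \<and> 1 < x \<and> (2 * y + 1 = x \<or> 2 * y + 1 = x * 3) \<or> even x \<and> 2 < x \<and> odd y \<and>
      (2 * y + 2 = x \<or> 2 * y + 2 = x * 2 \<or> 2 * y + 2 = x * 3 \<or> 2 * y + 2 = x * 4)) \<and> y < 2 * x"
    by (elim disjE exE conjE) simp_all
  then show ?L by (auto simp del: One_nat_def)
qed

text \<open>The length formulas are solved for the parameter. Formulas with \<open>div 2\<close>
  give two pairs for each \<open>n\<close>, the others at most one; the lower bounds on
  \<open>n\<close> come from the least parameter value.\<close>

lemma mem_reduced_pairs_iff:
  "(x, y) \<in> reduced_pairs n \<longleftrightarrow>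
    1 \<le> n \<and> (x, y) \<in> {(4 * n - 1, 2 * n - 1), (4 * n + 1, 2 * n), (8 * n - 4, 4 * n - 3)} \<or>
    2 \<le> n \<and> (x, y) = (2 * n, 2 * n - 1) \<or>
    n = 2 \<and> (x, y) = (3, 4) \<or>
    n = 3 \<and> (x, y) = (4, 5) \<or>
    3 \<le> n \<and> (x, y) \<in> {(4 * n - 7, 6 * n - 11), (4 * n - 5, 6 * n - 8), (8 * n - 16, 4 * n - 9),
      (8 * n - 16, 12 * n - 25)} \<or>
    5 \<le> n \<and> (x, y) = (8 * n - 28, 12 * n - 43) \<or>
    7 \<le> n \<and> n mod 4 = 3 \<and> (x, y) = ((n + 1) div 2, n)"
    (is "_ \<longleftrightarrow> ?R")
proof -
  let ?c = "chain_len (2 * x) y = n"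
  have 1: "(1 \<le> y \<and> x = 2 * y + 1) \<and> ?c \<longleftrightarrow>
      1 \<le> n \<and> (x = 4 * n - 1 \<and> y = 2 * n - 1 \<or> x = 4 * n + 1 \<and> y = 2 * n)"
  proof -
    have "(1 \<le> y \<and> x = 2 * y + 1) \<and> ?c \<longleftrightarrow> 1 \<le> y \<and> x = 2 * y + 1 \<and> n = (y + 1) div 2"
      using chain_len_odd(1)[of y] by auto
    moreover have "1 \<le> y \<and> n = (y + 1) div 2 \<longleftrightarrow> 1 \<le> n \<and> (y = 2 * n - 1 \<or> y = 2 * n)"
      by presburger
    ultimately show ?thesis by auto
  qed
  have 2: "(x = 3 \<and> y = 4) \<and> ?c \<longleftrightarrow> n = 2 \<and> x = 3 \<and> y = 4"
    "(x = 4 \<and> y = 5) \<and> ?c \<longleftrightarrow> n = 3 \<and> x = 4 \<and> y = 5"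
    using chain_len_small by auto
  have 3: "(\<exists>t\<ge>2. x = 2 * t + 1 \<and> y = 3 * t + 1) \<and> ?c \<longleftrightarrow>
      3 \<le> n \<and> (x = 4 * n - 7 \<and> y = 6 * n - 11 \<or> x = 4 * n - 5 \<and> y = 6 * n - 8)"
    (is "?A \<longleftrightarrow> ?B")
  proof
    assume ?A
    then obtain t where t: "2 \<le> t" "x = 2 * t + 1" "y = 3 * t + 1" and ?c by blast
    then have "n = t div 2 + 2" using chain_len_odd(2)[of t] by simp
    then have "3 \<le> n \<and> (t = 2 * n - 4 \<or> t = 2 * n - 3)" using t(1) by linarith
    then show ?B using t by auto
  next
    assume B: ?B
    then obtain s where s: "n = s + 3" by (metis le_Suc_ex add.commute)
    \<comment> \<open>\<open>x = 4 * n - 7 = 4 * s + 5\<close> belongs to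
      \<open>t = 2 * n - 4\<close>, the other value of \<open>x\<close> to
      \<open>t = 2 * n - 3\<close>.\<close>
    define t where "t = (if x = 4 * s + 5 then 2 * s + 2 else 2 * s + 3)"
    have t: "2 \<le> t" "x = 2 * t + 1" "y = 3 * t + 1" "n = t div 2 + 2"
      using B unfolding s t_def by auto
    have ?c unfolding t(2-4) using chain_len_odd(2)[OF t(1)] by simp
    then show ?A using t(1-3) by blast
  qed
  have family: "(\<exists>p. x = a p \<and> y = b p) \<and> ?c \<longleftrightarrow> (\<exists>p. x = a p \<and> y = b p \<and> n = l p)"
    if "\<And>p. chain_len (2 * a p) (b p) = l p" for a b l :: "nat \<Rightarrow> nat"
    using that by blast
  have 4: "(\<exists>p. x = 8 * p + 4 \<and> y = 4 * p + 1) \<and> ?c \<longleftrightarrow>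
      1 \<le> n \<and> x = 8 * n - 4 \<and> y = 4 * n - 3"
    unfolding family[where l = "\<lambda>p. p + 1", OF chain_len_even_1(1)]
    by (auto intro!: exI[of _ "n - 1"])
  have 5: "(\<exists>p. x = 8 * p + 8 \<and> y = 4 * p + 3) \<and> ?c \<longleftrightarrow>
      3 \<le> n \<and> x = 8 * n - 16 \<and> y = 4 * n - 9"
    unfolding family[where l = "\<lambda>p. p + 3", OF chain_len_even_1(2)]
    by (auto intro!: exI[of _ "n - 3"])
  have 6: "(\<exists>q. x = 2 * q + 4 \<and> y = 2 * q + 3) \<and> ?c \<longleftrightarrow>
      2 \<le> n \<and> x = 2 * n \<and> y = 2 * n - 1"
    unfolding family[where l = "\<lambda>q. q + 2", OF chain_len_even_2]
    by (auto intro!: exI[of _ "n - 2"])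
  have 7: "(\<exists>p. x = 8 * p + 8 \<and> y = 12 * p + 11) \<and> ?c \<longleftrightarrow>
      3 \<le> n \<and> x = 8 * n - 16 \<and> y = 12 * n - 25"
    unfolding family[where l = "\<lambda>p. p + 3", OF chain_len_even_3(1)]
    by (auto intro!: exI[of _ "n - 3"])
  have 8: "(\<exists>p. x = 8 * p + 12 \<and> y = 12 * p + 17) \<and> ?c \<longleftrightarrow>
      5 \<le> n \<and> x = 8 * n - 28 \<and> y = 12 * n - 43"
    unfolding family[where l = "\<lambda>p. p + 5", OF chain_len_even_3(2)]
    by (auto intro!: exI[of _ "n - 5"])
  have 9: "(\<exists>q. x = 2 * q + 4 \<and> y = 4 * q + 7) \<and> ?c \<longleftrightarrow>
      7 \<le> n \<and> n mod 4 = 3 \<and> x = (n + 1) div 2 \<and> y = n"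
    (is "_ \<longleftrightarrow> ?B")
  proof -
    have "\<exists>q. x = 2 * q + 4 \<and> y = 4 * q + 7 \<and> n = 4 * q + 7" if B: ?B
    proof -
      \<comment> \<open>Solves \<open>n = 4 * q + 7\<close>.\<close>
      define q where "q = n div 4 - 1"
      have "n = 4 * q + 7" unfolding q_def using B by presburger
      then show ?thesis using B by (intro exI[of _ q]) simp
    qed
    moreover have ?B if "x = 2 * q + 4" "y = 4 * q + 7" "n = 4 * q + 7" for q
      using that by simp
    ultimately show ?thesis
      unfolding family[where l = "\<lambda>q. 4 * q + 7", OF chain_len_even_4] by blast
  qed
  have "(x, y) \<in> reduced_pairs n \<longleftrightarrow>
     ((odd x \<and> 1 < x \<and> x dvd 2 * y + 1 \<or> even x \<and> 2 < x \<and> odd y \<and> x dvd 2 * y + 2) \<and> y < 2 * x) \<and> ?c"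
    unfolding reduced_pairs_def smooth_pairs_def co_mod_dvd_iff[symmetric] by auto
  also have "\<dots> \<longleftrightarrow> ?R"
    unfolding reduced_cases
    unfolding conj_disj_distribR 1 2 3 4 5 6 7 8 9 insert_iff empty_iff prod.inject
    by (simp only: simp_thms conj_disj_distribL disj_ac)
  finally show ?thesis .
qed

section \<open>Counting\<close>

lemma reduced_pairs_small:
  "reduced_pairs 1 = {(3, 1), (5, 2), (4, 1)}"
  "reduced_pairs 2 = {(7, 3), (9, 4), (12, 5), (4, 3), (3, 4)}"
  "reduced_pairs 3 = {(11, 5), (13, 6), (20, 9), (6, 5), (4, 5), (5, 7), (7, 10), (8, 3), (8, 11)}"
  "reduced_pairs 4 = {(15, 7), (17, 8), (28, 13), (8, 7), (9, 13), (11, 16), (16, 7), (16, 23)}"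
  by (rule set_eqI, simp only: split_paired_all, simp add: mem_reduced_pairs_iff disj_ac)+

text \<open>From 5 on all lower bounds hold; the bound 7 of the last family follows from
  \<open>n mod 4 = 3\<close>.\<close>

lemma reduced_pairs_large:
  assumes "5 \<le> n"
  shows "reduced_pairs n =
    {(4 * n - 1, 2 * n - 1), (4 * n + 1, 2 * n), (8 * n - 4, 4 * n - 3), (2 * n, 2 * n - 1),
     (4 * n - 7, 6 * n - 11), (4 * n - 5, 6 * n - 8), (8 * n - 16, 4 * n - 9),
     (8 * n - 16, 12 * n - 25), (8 * n - 28, 12 * n - 43)} \<union>
    (if n mod 4 = 3 then {((n + 1) div 2, n)} else {})"
    (is "_ = ?A \<union> ?B")
proof -
  have "7 \<le> n" if "n mod 4 = 3" using assms that by presburger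
  then have n: "1 \<le> n" "2 \<le> n" "3 \<le> n" "n \<noteq> 2" "n \<noteq> 3" "n mod 4 = 3 \<longrightarrow> 7 \<le> n"
    using assms by auto
  have "(x, y) \<in> reduced_pairs n \<longleftrightarrow> (x, y) \<in> ?A \<union> ?B" for x y
  proof (cases "n mod 4 = 3")
    case True
    then show ?thesis
      using n assms
      by (simp only: mem_reduced_pairs_iff Un_iff insert_iff empty_iff if_True simp_thms disj_ac)
  next
    case False
    then show ?thesis
      using n assms
      by (simp only: mem_reduced_pairs_iff Un_iff insert_iff empty_iff if_False simp_thms disj_ac)
  qed
  then show ?thesis by (intro set_eqI) (simp only: split_paired_all)
qed

lemma finite_reduced_pairs: "finite (reduced_pairs n)"
proof -
  have "reduced_pairs n \<subseteq> {..8 * n + 4} \<times> {..12 * n + 5}"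
    by (auto simp: mem_reduced_pairs_iff)
  then show ?thesis by (rule finite_subset) simp
qed

lemma card_reduced_pairs:
  "card (reduced_pairs 1) = 3" "card (reduced_pairs 2) = 5"
  "card (reduced_pairs 3) = 9" "card (reduced_pairs 4) = 8"
  "5 \<le> n \<Longrightarrow> card (reduced_pairs n) = 9 + of_bool (n mod 4 = 3)"
proof -
  show "card (reduced_pairs n) = 9 + of_bool (n mod 4 = 3)" if n: "5 \<le> n"
  proof -
    define A where "A = {(4 * n - 1, 2 * n - 1), (4 * n + 1, 2 * n), (8 * n - 4, 4 * n - 3),
      (2 * n, 2 * n - 1), (4 * n - 7, 6 * n - 11), (4 * n - 5, 6 * n - 8), (8 * n - 16, 4 * n - 9),
      (8 * n - 16, 12 * n - 25), (8 * n - 28, 12 * n - 43)}"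
    \<comment> \<open>Clears the truncated subtractions, so that linear arithmetic can tell the
      pairs apart.\<close>
    obtain k where k: "n = k + 5" using n by (metis le_Suc_ex add.commute)
    have "card A = 9" unfolding A_def k by (simp add: card_insert_if; presburger)
    moreover have "((n + 1) div 2, n) \<notin> A"
      unfolding A_def k by (simp; presburger)
    moreover have "finite A" by (simp add: A_def)
    ultimately show ?thesis
      unfolding reduced_pairs_large[OF n] A_def[symmetric] by simp
  qed
qed (simp_all only: reduced_pairs_small, simp_all)

lemma finite_smooth_pairs: "finite (smooth_pairs n)"
  by (induction n) (simp_all add: smooth_pairs_0 smooth_pairs_Suc finite_reduced_pairs)

text \<open>The union is disjoint: a shifted pair has second entry at least \<open>2 * x\<close>, a
  reduced one less.\<close>

lemma card_smooth_pairs_Suc: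
  "card (smooth_pairs (Suc n)) = card (smooth_pairs n) + card (reduced_pairs (Suc n))"
proof -
  let ?f = "\<lambda>(x, y). (x, y + 2 * x) :: nat \<times> nat"
  have "?f ` smooth_pairs n \<inter> reduced_pairs (Suc n) = {}"
    by (auto simp: reduced_pairs_def)
  moreover have "inj_on ?f (smooth_pairs n)" by (auto simp: inj_on_def)
  ultimately show ?thesis
    by (simp add: smooth_pairs_Suc card_Un_disjoint finite_smooth_pairs finite_reduced_pairs card_image)
qed

lemma card_smooth_pairs_small:
  "card (smooth_pairs 1) = 3" "card (smooth_pairs 2) = 8" "card (smooth_pairs 3) = 17"
  "card (smooth_pairs 4) = 25"
proof -
  show 1: "card (smooth_pairs 1) = 3"
    using card_smooth_pairs_Suc[of 0] card_reduced_pairs(1) by (simp add: smooth_pairs_0)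
  show 2: "card (smooth_pairs 2) = 8"
    using card_smooth_pairs_Suc[of 1] 1 card_reduced_pairs(2) by (simp add: numeral_2_eq_2)
  show 3: "card (smooth_pairs 3) = 17"
    using card_smooth_pairs_Suc[of 2] 2 card_reduced_pairs(3) by simp
  show "card (smooth_pairs 4) = 25"
    using card_smooth_pairs_Suc[of 3] 3 card_reduced_pairs(4) by simp
qed

lemma card_smooth_pairs:
  "4 \<le> n \<Longrightarrow> card (smooth_pairs n) = 9 * n - 11 + (n - 3) div 4"
proof (induction n rule: nat_induct_at_least)
  case base
  then show ?case by (simp add: card_smooth_pairs_small)
next
  case (Suc n)
  obtain s where s: "n = s + 3" using Suc.hyps le_Suc_ex[of 3 n] by (auto simp: add.commute)
  \<comment> \<open>The floor rises exactly when 4 divides \<open>Suc n - 3\<close>, which is when a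
    tenth reduced pair exists.\<close>
  have "(Suc n - 3) div 4 = (n - 3) div 4 + of_bool (Suc n mod 4 = 3)"
    unfolding s by (simp add: div_Suc mod_Suc)
  then show ?case
    using Suc card_reduced_pairs(5)[of "Suc n"] by (simp add: card_smooth_pairs_Suc)
qed

theorem theorem4p2:
  shows "(\<forall>n\<ge>4. card (smooth_structures n) = 9 * n - 11 + (n - 3) div 4)
    \<and> card (smooth_structures 3) = 17
    \<and> card (smooth_structures 2) = 8
    \<and> card (smooth_structures 1) = 3"
  by (simp add: card_smooth_structures card_smooth_pairs card_smooth_pairs_small del: One_nat_def)

end
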